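(* Let $k,m$ be positive integers with $m\ge 5$ and let $b\in\{0,2,4,\ldots\}$. If $b\equiv 0\pmod 4$, then $$E_{k\varphi(5^m)+b}-(1-5^b)E_b\equiv 5^{m-1}k(3130-4000b+3375b^2+3125b^3-3125b^4)\pmod{5^{m+5}}.$$ If $b\equiv 2\pmod 4$, then $$E_{k\varphi(5^m)+b}-(1-5^b)E_b\equiv 5^{m-1}k(4790+1750b^2+3125b^3+6250b^4)\pmod{5^{m+5}}.$$
   Context: The Euler numbers $\{E_n\}_{n\ge0}$ are the integers defined by $E_0=1$, $E_{2n-1}=0$ and $\sum_{r=0}^n\binom{2n}{2r}E_{2r}=0$ for $n=1,2,3,\ldots$. $\varphi$ denotes Euler's totient function. *)

theory Defs
  imports "HOL-Number_Theory.Number_Theory"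
begin

text \<open>
  The defining relation \<open>(\<Sum>r\<le>n. (2n choose 2r) * E (2r)) = 0\<close> for \<open>n \<ge> 1\<close> is solved
  for its top term, whose coefficient is 1.
\<close>

function euler_number :: "nat \<Rightarrow> int" where
  "euler_number n =
     (if n = 0 then 1
      else if odd n then 0
      else - (\<Sum>r<n div 2. int (n choose (2 * r)) * euler_number (2 * r)))"
  by auto
termination by (relation "Wellfounded.measure id") auto

declare euler_number.simps [simp del]

lemma euler_number_0: "euler_number 0 = 1"
  by (simp add: euler_number.simps)

lemma euler_number_odd: "n \<ge> 1 \<Longrightarrow> euler_number (2 * n - 1) = 0"
  by (subst euler_number.simps) auto

lemma euler_number_sum:
  assumes "n \<ge> 1"
  shows "(\<Sum>r=0..n. int ((2 * n) choose (2 * r)) * euler_number (2 * r)) = 0"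
proof -
  have "euler_number (2 * n) =
          - (\<Sum>r<n. int ((2 * n) choose (2 * r)) * euler_number (2 * r))"
    using assms by (subst euler_number.simps) simp
  moreover have "{0..n} = insert n {..<n}" by auto
  ultimately show ?thesis by simp
qed

end

theory Submission
  imports Defs
begin

text \<open>
  Modulo an odd \<open>N\<close>, \<open>E\<^sub>n\<close> is the alternating sum of \<open>(2j + 1)\<^sup>n\<close> over \<open>j < N\<close>, because these sums
  satisfy the defining recurrence of the Euler numbers up to a telescoping sum. Taking \<open>N\<close> a
  power of 5 and dropping the bases divisible by 5 replaces \<open>E\<^sub>n\<close> by \<open>G n = (1 - 5\<^sup>n) E\<^sub>n\<close>; since the
  remaining bases satisfy \<open>x\<^sup>4 = 1\<close> modulo 5, the \<open>r\<close>-th differences with step 4 of \<open>G\<close> are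
  divisible by \<open>5\<^sup>r\<close>. Expanding \<open>G (b + 4A)\<close> for \<open>A = 5\<^bsup>m-1\<^esup>k\<close> by Newton's forward formula and
  keeping the part linear in \<open>A\<close> gives \<open>A\<close> times \<open>log (1 + \<Delta>)\<close>, truncated after order 5, applied to
  \<open>G\<close>. The fifth difference of that expression vanishes to the required precision, so it is a
  quartic polynomial in \<open>b\<close>, determined by five values in each residue class modulo 4.
\<close>

section \<open>Forward differences and Newton's formula\<close>

definition fdiff :: "(nat \<Rightarrow> int) \<Rightarrow> nat \<Rightarrow> int" where
  "fdiff f n = f (Suc n) - f n"

text \<open>The shift operator is \<open>1 + \<Delta>\<close> with \<open>\<Delta>\<close> =
  \<open>fdiff\<close>, so this is the binomial expansion of its \<open>n\<close>-th power; the
  induction step is Pascal's rule.\<close>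

lemma newton_forward:
  "f (t + n) = (\<Sum>i\<le>n. int (n choose i) * (fdiff ^^ i) f t)"
proof (induction n arbitrary: t)
  case (Suc n)
  have "f (t + Suc n) = f (Suc t + n)" by simp
  also have "\<dots> = (\<Sum>i\<le>n. int (n choose i) * (fdiff ^^ i) f (Suc t))"
    by (rule Suc.IH)
  also have "\<dots> = (\<Sum>i\<le>n. int (n choose i) * ((fdiff ^^ i) f t + (fdiff ^^ Suc i) f t))"
    by (simp add: fdiff_def)
  also have "\<dots> = (\<Sum>i\<le>n. int (n choose i) * (fdiff ^^ i) f t) + (\<Sum>i\<le>n. int (n choose i) * (fdiff ^^ Suc i) f t)"
    by (simp add: distrib_left sum.distrib)
  also have "(\<Sum>i\<le>n. int (n choose i) * (fdiff ^^ i) f t)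
       = (\<Sum>i\<le>Suc n. int (n choose i) * (fdiff ^^ i) f t)" by simp
  also have "\<dots> = f t + (\<Sum>i\<le>n. int (n choose Suc i) * (fdiff ^^ Suc i) f t)"
    by (subst sum.atMost_Suc_shift) simp
  also have "\<dots> + (\<Sum>i\<le>n. int (n choose i) * (fdiff ^^ Suc i) f t)
       = f t + (\<Sum>i\<le>n. int (Suc n choose Suc i) * (fdiff ^^ Suc i) f t)"
    by (simp add: algebra_simps sum.distrib del: funpow.simps)
  also have "\<dots> = (\<Sum>i\<le>Suc n. int (Suc n choose i) * (fdiff ^^ i) f t)"
    by (subst sum.atMost_Suc_shift) simp
  finally show ?case .
qed simp

lemma cong_funpow_fdiff:
  assumes "\<And>t. [f t = g t] (mod n)"
  shows "[(fdiff ^^ r) f t = (fdiff ^^ r) g t] (mod n)"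
  by (induction r arbitrary: t) (auto simp: fdiff_def intro: assms cong_diff)

text \<open>A geometric sequence \<open>u ^ t\<close> is an eigenvector of \<open>fdiff\<close> with
  eigenvalue \<open>u - 1\<close>.\<close>

lemma funpow_fdiff_exp_sum:
  "(fdiff ^^ r) (\<lambda>t. \<Sum>j\<in>J. w j * u j ^ t) t = (\<Sum>j\<in>J. w j * (u j - 1) ^ r * u j ^ t)"
  by (induction r arbitrary: t)
     (auto simp: fdiff_def algebra_simps simp flip: sum_subtractf)

section \<open>Euler numbers as alternating power sums\<close>

text \<open>Summing over the even binomial coefficients turns the powers of \<open>2 * j + 1\<close>
  into half of \<open>(2 * j + 2) ^ (2 * n) + (2 * j) ^ (2 * n)\<close>, whose alternating sum over
  \<open>j\<close> telescopes to a multiple of \<open>N\<close>.\<close>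

lemma euler_number_cong_alternating_sum:
  fixes N :: nat
  assumes "odd N"
  shows "[euler_number (2 * n) = (\<Sum>j<N. (- 1) ^ j * (2 * int j + 1) ^ (2 * n))] (mod int N)"
proof (induction n rule: less_induct)
  case (less n)
  define T where "T i = (\<Sum>j<N. (- 1) ^ j * (2 * int j + 1) ^ i)" for i :: nat
  have alt: "(\<Sum>j<N. (- 1) ^ j * (a (Suc j) + a j)) = a 0 - (- 1) ^ N * a N"
    for N :: nat and a :: "nat \<Rightarrow> int"
    by (induction N) (auto simp: algebra_simps)
  show ?case
  proof (cases "n = 0")
    case True
    have "(\<Sum>j<N. (- 1) ^ j :: int) = (if odd N then 1 else 0)" for N :: nat
      by (induction N) auto
    with True assms show ?thesis by (simp add: euler_number_0)
  next
    case False
    \<comment> \<open>In the sum of the two expansions the odd powers cancel and the even ones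
      double.\<close>
    have even_part: "(\<Sum>r\<le>n. int ((2 * n) choose (2 * r)) * x ^ (2 * r)) * 2
        = (x + 1) ^ (2 * n) + (x - 1) ^ (2 * n)" for x :: int
    proof -
      have "(x + 1) ^ (2 * n) + (x - 1) ^ (2 * n)
          = (x + 1) ^ (2 * n) + (1 + - x) ^ (2 * n)"
        by (simp add: power_mult power2_commute[of x 1])
      also have "\<dots> = (\<Sum>i\<le>2 * n. int (2 * n choose i) * (x ^ i + (- x) ^ i))"
        by (subst binomial_ring, subst add.commute[of 1], subst binomial_ring)
           (simp add: sum.distrib distrib_left)
      also have "\<dots> = (\<Sum>i | i \<le> 2 * n \<and> even i. int (2 * n choose i) * (x ^ i + (- x) ^ i))"
        by (rule sum.mono_neutral_right) (auto simp: power_minus_odd)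
      also have "\<dots> = (\<Sum>r\<le>n. int (2 * n choose (2 * r)) * (x ^ (2 * r) + (- x) ^ (2 * r)))"
        by (rule sum.reindex_bij_witness[of _ "\<lambda>r. 2 * r" "\<lambda>i. i div 2"]) auto
      finally show ?thesis by (simp add: sum_distrib_left mult_ac)
    qed
    have "2 * (\<Sum>r\<le>n. int ((2 * n) choose (2 * r)) * T (2 * r))
        = (\<Sum>j<N. (- 1) ^ j * ((\<Sum>r\<le>n. int ((2 * n) choose (2 * r)) * (2 * int j + 1) ^ (2 * r)) * 2))"
      unfolding T_def sum_distrib_left sum_distrib_right
      by (subst sum.swap) (intro sum.cong refl, simp only: mult_ac)
    also have "\<dots> = (\<Sum>j<N. (- 1) ^ j * ((2 * int (Suc j)) ^ (2 * n) + (2 * int j) ^ (2 * n)))"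
      unfolding even_part by (simp add: add.commute)
    \<comment> \<open>The lower boundary term vanishes because \<open>n > 0\<close>, and the upper
      one has sign \<open>+\<close> because \<open>N\<close> is odd.\<close>
    also have "\<dots> = (2 * int N) ^ (2 * n)"
      using alt[where a = "\<lambda>j. (2 * int j) ^ (2 * n)"] False assms by simp
    \<comment> \<open>One factor 2 is split off so that the doubling cancels over the integers and
      still leaves a multiple of \<open>N\<close>.\<close>
    also have "\<dots> = 2 * (int N * (2 * int N) ^ (2 * n - 1))"
      using False by (cases n) auto
    finally have "int N dvd (\<Sum>r\<le>n. int ((2 * n) choose (2 * r)) * T (2 * r))"
      by simp
    moreover have "{..n} = insert n {..<n}" by auto
    ultimately have "[T (2 * n) + (\<Sum>r<n. int ((2 * n) choose (2 * r)) * T (2 * r)) = 0] (mod int N)"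
      by (simp add: cong_0_iff)
    moreover have "euler_number (2 * n) + (\<Sum>r<n. int ((2 * n) choose (2 * r)) * euler_number (2 * r)) = 0"
      using False by (subst euler_number.simps) simp
    moreover have "[(\<Sum>r<n. int ((2 * n) choose (2 * r)) * euler_number (2 * r))
        = (\<Sum>r<n. int ((2 * n) choose (2 * r)) * T (2 * r))] (mod int N)"
      using less.IH unfolding T_def by (intro cong_sum cong_scalar_left) auto
    ultimately have "[euler_number (2 * n) = T (2 * n)] (mod int N)"
      by (simp add: cong_iff_dvd_diff) (smt (verit) dvd_add dvd_diff)
    then show ?thesis by (simp add: T_def)
  qed
qed

section \<open>Removing the Euler factor at 5; Kummer congruences\<close>

text \<open>The function \<open>G\<close> of the overview. For even \<open>n\<close>, half of the
  \<open>n\<close>-th Euler number is the value at \<open>- n\<close> of the L-function of the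
  nontrivial character modulo 4, and \<open>1 - 5 ^ n\<close> is the inverse Euler factor at
  5.\<close>

definition euler_number_5 :: "nat \<Rightarrow> int" where
  "euler_number_5 n = (1 - 5 ^ n) * euler_number n"

text \<open>The bases divisible by 5 are those with \<open>j = 5 * i + 2\<close>. There the base is
  \<open>5 * (2 * i + 1)\<close> and the sign is that of \<open>i\<close>, so together they give
  \<open>5 ^ n\<close> times the sum of length \<open>5 ^ M\<close>.\<close>

lemma euler_number_5_cong_alternating_sum:
  assumes "even n"
  shows "[euler_number_5 n = (\<Sum>j | j < 5 ^ Suc M \<and> \<not> 5 dvd 2 * j + 1. (- 1) ^ j * (2 * int j + 1) ^ n)] (mod 5 ^ M)"
proof -
  define f where "f j = (- 1) ^ j * (2 * int j + 1) ^ n" for j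
  obtain r where n: "n = 2 * r" using assms by blast
  have E: "[euler_number n = (\<Sum>j<5 ^ i. f j)] (mod 5 ^ i)" for i
    using euler_number_cong_alternating_sum[of "5 ^ i" r] by (simp add: n f_def)
  have "(\<Sum>j<5 ^ Suc M. f j) = (\<Sum>j | j < 5 ^ Suc M \<and> \<not> 5 dvd 2 * j + 1. f j)
      + (\<Sum>j | j < 5 ^ Suc M \<and> 5 dvd 2 * j + 1. f j)"
    by (subst sum.union_disjoint[symmetric]) (auto intro: sum.cong)
  also have "(\<Sum>j | j < 5 ^ Suc M \<and> 5 dvd 2 * j + 1. f j) = (\<Sum>i<5 ^ M. f (5 * i + 2))"
  proof (rule sum.reindex_bij_witness[of _ "\<lambda>i. 5 * i + 2" "\<lambda>j. j div 5"])
    fix j assume "j \<in> {j::nat. j < 5 ^ Suc M \<and> 5 dvd 2 * j + 1}"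
    then show *: "5 * (j div 5) + 2 = j" and "j div 5 \<in> {..<5 ^ M}"
      by (auto simp: div_less_iff_less_mult) presburger
    show "f (5 * (j div 5) + 2) = f j" by (simp only: *)
  next
    fix i :: nat assume "i \<in> {..<5 ^ M}"
    moreover have "2 * (5 * i + 2) + 1 = 5 * (2 * i + 1)" by simp
    ultimately show "5 * i + 2 \<in> {j::nat. j < 5 ^ Suc M \<and> 5 dvd 2 * j + 1}"
      by (simp del: mult_Suc_right)
  qed simp
  also have "\<dots> = 5 ^ n * (\<Sum>i<5 ^ M. f i)"
  proof -
    have "f (5 * i + 2) = 5 ^ n * f i" for i
    proof -
      have "2 * int (5 * i + 2) + 1 = 5 * (2 * int i + 1)" by simp
      then show ?thesis
        unfolding f_def by (simp only: power_mult_distrib) (simp add: power_add power_mult)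
    qed
    then show ?thesis by (simp add: sum_distrib_left)
  qed
  finally have "(\<Sum>j | j < 5 ^ Suc M \<and> \<not> 5 dvd 2 * j + 1. f j)
      = (\<Sum>j<5 ^ Suc M. f j) - 5 ^ n * (\<Sum>i<5 ^ M. f i)" by simp
  \<comment> \<open>The long sum is controlled modulo \<open>5 ^ Suc M\<close>, the short one only
    modulo \<open>5 ^ M\<close>; the latter is the common precision.\<close>
  moreover have "[euler_number n = (\<Sum>j<5 ^ Suc M. f j)] (mod 5 ^ M)"
    by (rule cong_dvd_modulus[OF E[of "Suc M"]]) simp
  ultimately have "[euler_number n - 5 ^ n * euler_number n
      = (\<Sum>j | j < 5 ^ Suc M \<and> \<not> 5 dvd 2 * j + 1. f j)] (mod 5 ^ M)"
    using cong_diff[OF _ cong_scalar_left[OF E[of M]]] by simp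
  then show ?thesis by (simp add: euler_number_5_def f_def algebra_simps)
qed

text \<open>For a base \<open>x\<close> prime to 5, the \<open>r\<close>-th difference brings in the
  factor \<open>(x ^ 4 - 1) ^ r\<close>, and Fermat's theorem gives one 5 per factor. The sum is
  taken with precision \<open>5 ^ r\<close>, just enough for the claim.\<close>

lemma kummer_congruence_5:
  assumes "even b"
  shows "5 ^ r dvd (fdiff ^^ r) (\<lambda>t. euler_number_5 (b + 4 * t)) t"
proof -
  define J where "J = {j::nat. j < 5 ^ Suc r \<and> \<not> 5 dvd 2 * j + 1}"
  let ?x = "\<lambda>j. 2 * int j + 1"
  have "[(fdiff ^^ r) (\<lambda>t. euler_number_5 (b + 4 * t)) t
      = (fdiff ^^ r) (\<lambda>t. \<Sum>j\<in>J. ((- 1) ^ j * ?x j ^ b) * (?x j ^ 4) ^ t) t] (mod 5 ^ r)"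
  proof (rule cong_funpow_fdiff)
    fix t
    show "[euler_number_5 (b + 4 * t) = (\<Sum>j\<in>J. ((- 1) ^ j * ?x j ^ b) * (?x j ^ 4) ^ t)] (mod 5 ^ r)"
      using euler_number_5_cong_alternating_sum[of "b + 4 * t" r] assms
      unfolding J_def by (simp add: power_add power_mult mult.assoc)
  qed
  moreover have "5 ^ r dvd (fdiff ^^ r) (\<lambda>t. \<Sum>j\<in>J. ((- 1) ^ j * ?x j ^ b) * (?x j ^ 4) ^ t) t"
    unfolding funpow_fdiff_exp_sum
  proof (rule dvd_sum)
    fix j assume "j \<in> J"
    then have "[(2 * j + 1) ^ (5 - 1) = 1] (mod 5)"
      by (intro fermat_theorem) (auto simp: J_def)
    then have "[int ((2 * j + 1) ^ (5 - 1)) = int 1] (mod int 5)"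
      by (simp only: cong_int_iff)
    then have "5 dvd ?x j ^ 4 - 1"
      by (simp add: cong_iff_dvd_diff add.commute)
    then show "5 ^ r dvd (- 1) ^ j * ?x j ^ b * (?x j ^ 4 - 1) ^ r * (?x j ^ 4) ^ t"
      by (intro dvd_mult dvd_mult2 dvd_power_same)
  qed
  ultimately show ?thesis by (simp add: cong_dvd_iff)
qed

section \<open>Explicit Euler numbers\<close>

lemma euler_number_rec:
  "n > 0 \<Longrightarrow> euler_number (2 * n) = - (\<Sum>r<n. int (2 * n choose (2 * r)) * euler_number (2 * r))"
  by (subst euler_number.simps) simp

text \<open>The base cases evaluate \<open>log_fdiff\<close> at \<open>t \<le> 4\<close>, which
  reads values up to \<open>t + 5 \<le> 9\<close>; the largest index is thus
  \<open>2 + 4 * 9 = 38\<close>.\<close>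

lemma euler_number_values:
  "euler_number 0 = 1"
  "euler_number 2 = - 1"
  "euler_number 4 = 5"
  "euler_number 6 = - 61"
  "euler_number 8 = 1385"
  "euler_number 10 = - 50521"
  "euler_number 12 = 2702765"
  "euler_number 14 = - 199360981"
  "euler_number 16 = 19391512145"
  "euler_number 18 = - 2404879675441"
  "euler_number 20 = 370371188237525"
  "euler_number 22 = - 69348874393137901"
  "euler_number 24 = 15514534163557086905"
  "euler_number 26 = - 4087072509293123892361"
  "euler_number 28 = 1252259641403629865468285"
  "euler_number 30 = - 441543893249023104553682821"
  "euler_number 32 = 177519391579539289436664789665"
  "euler_number 34 = - 80723299235887898062168247453281"
  "euler_number 36 = 41222060339517702122347079671259045"
  "euler_number 38 = - 23489580527043108252017828576198947741"
proof -
  show 0: "euler_number 0 = 1" by (rule euler_number_0)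
  show 2: "euler_number 2 = - 1"
    using euler_number_rec[of 1] by (simp add: binomial_fact' fact_numeral lessThan_nat_numeral 0)
  show 4: "euler_number 4 = 5"
    using euler_number_rec[of 2] by (simp add: binomial_fact' fact_numeral lessThan_nat_numeral 0 2)
  show 6: "euler_number 6 = - 61"
    using euler_number_rec[of 3] by (simp add: binomial_fact' fact_numeral lessThan_nat_numeral 0 2 4)
  show 8: "euler_number 8 = 1385"
    using euler_number_rec[of 4] by (simp add: binomial_fact' fact_numeral lessThan_nat_numeral 0 2 4 6)
  show 10: "euler_number 10 = - 50521"
    using euler_number_rec[of 5] by (simp add: binomial_fact' fact_numeral lessThan_nat_numeral 0 2 4 6 8)
  show 12: "euler_number 12 = 2702765"
    using euler_number_rec[of 6] by (simp add: binomial_fact' fact_numeral lessThan_nat_numeral 0 2 4 6 8 10)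
  show 14: "euler_number 14 = - 199360981"
    using euler_number_rec[of 7] by (simp add: binomial_fact' fact_numeral lessThan_nat_numeral 0 2 4 6 8 10 12)
  show 16: "euler_number 16 = 19391512145"
    using euler_number_rec[of 8] by (simp add: binomial_fact' fact_numeral lessThan_nat_numeral 0 2 4 6 8 10 12 14)
  show 18: "euler_number 18 = - 2404879675441"
    using euler_number_rec[of 9] by (simp add: binomial_fact' fact_numeral lessThan_nat_numeral 0 2 4 6 8 10 12 14 16)
  show 20: "euler_number 20 = 370371188237525"
    using euler_number_rec[of 10] by (simp add: binomial_fact' fact_numeral lessThan_nat_numeral 0 2 4 6 8 10 12 14 16 18)
  show 22: "euler_number 22 = - 69348874393137901"
    using euler_number_rec[of 11] by (simp add: binomial_fact' fact_numeral lessThan_nat_numeral 0 2 4 6 8 10 12 14 16 18 20)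
  show 24: "euler_number 24 = 15514534163557086905"
    using euler_number_rec[of 12] by (simp add: binomial_fact' fact_numeral lessThan_nat_numeral 0 2 4 6 8 10 12 14 16 18 20 22)
  show 26: "euler_number 26 = - 4087072509293123892361"
    using euler_number_rec[of 13] by (simp add: binomial_fact' fact_numeral lessThan_nat_numeral 0 2 4 6 8 10 12 14 16 18 20 22 24)
  show 28: "euler_number 28 = 1252259641403629865468285"
    using euler_number_rec[of 14] by (simp add: binomial_fact' fact_numeral lessThan_nat_numeral 0 2 4 6 8 10 12 14 16 18 20 22 24 26)
  show 30: "euler_number 30 = - 441543893249023104553682821"
    using euler_number_rec[of 15] by (simp add: binomial_fact' fact_numeral lessThan_nat_numeral 0 2 4 6 8 10 12 14 16 18 20 22 24 26 28)
  show 32: "euler_number 32 = 177519391579539289436664789665"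
    using euler_number_rec[of 16] by (simp add: binomial_fact' fact_numeral lessThan_nat_numeral 0 2 4 6 8 10 12 14 16 18 20 22 24 26 28 30)
  show 34: "euler_number 34 = - 80723299235887898062168247453281"
    using euler_number_rec[of 17] by (simp add: binomial_fact' fact_numeral lessThan_nat_numeral 0 2 4 6 8 10 12 14 16 18 20 22 24 26 28 30 32)
  show 36: "euler_number 36 = 41222060339517702122347079671259045"
    using euler_number_rec[of 18] by (simp add: binomial_fact' fact_numeral lessThan_nat_numeral 0 2 4 6 8 10 12 14 16 18 20 22 24 26 28 30 32 34)
  show 38: "euler_number 38 = - 23489580527043108252017828576198947741"
    using euler_number_rec[of 19] by (simp add: binomial_fact' fact_numeral lessThan_nat_numeral 0 2 4 6 8 10 12 14 16 18 20 22 24 26 28 30 32 34 36)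
qed

section \<open>Binomial coefficients: 5-adic bound and polynomial form\<close>

text \<open>By \<open>i * (A choose i) = A * (A - 1 choose (i - 1))\<close>, the binomial
  coefficient loses at most the 5-part \<open>5 ^ v\<close> of \<open>i\<close> from the power of 5
  in \<open>A\<close>, and \<open>5 ^ i\<close> more than makes up for it. This disposes of the
  Newton terms of order at least 6.\<close>

lemma choose_dvd_bound:
  fixes A i m :: nat
  assumes "6 \<le> i" and "1 \<le> m" and "5 ^ (m - 1) dvd A"
  shows "5 ^ (m + 5) dvd (A choose i) * 5 ^ i"
proof -
  define v where "v = multiplicity 5 i"
  obtain u where u: "i = 5 ^ v * u" "\<not> 5 dvd u"
    using multiplicity_decompose'[of i "5::nat"] assms(1) unfolding v_def by auto
  have "i * (A choose i) = A * (A - 1 choose (i - 1))"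
    using assms(1) by (intro times_binomial_minus1_eq) simp
  then have "5 ^ (m - 1) dvd i * (A choose i)"
    using assms(3) by simp
  then have "5 ^ (m - 1) dvd u * (5 ^ v * (A choose i))"
    by (simp add: u(1) mult_ac)
  moreover have "coprime (5 ^ (m - 1)) u"
    using u(2) prime_imp_coprime[of 5 u] by simp
  ultimately have dvd: "5 ^ (m - 1) dvd 5 ^ v * (A choose i)"
    by (simp add: coprime_dvd_mult_right_iff)
  \<comment> \<open>For \<open>v = 1\<close> the least admissible \<open>i\<close> is 10; for
    \<open>v \<ge> 2\<close> already \<open>5 ^ v\<close> is large enough.\<close>
  have "v + 6 \<le> i"
  proof (cases "v \<le> 1")
    case True
    then consider "v = 0" | "v = 1" by linarith
    then show ?thesis
    proof cases
      case 2
      then have "5 dvd i" using u by simp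
      then show ?thesis using assms(1) 2 by presburger
    qed (use assms in simp)
  next
    case False
    have "v \<ge> 2 \<Longrightarrow> v + 6 \<le> 5 ^ v"
      by (induction v rule: dec_induct) auto
    with False have "v + 6 \<le> 5 ^ v" by simp
    also have "\<dots> \<le> i" using u assms(1) by (cases u) auto
    finally show ?thesis .
  qed
  then obtain d where d: "i = v + 6 + d" using le_Suc_ex by blast
  have "(5::nat) ^ (m + 5) = 5 ^ (m - 1) * 5 ^ 6"
    using assms(2) by (subst power_add[symmetric]) simp
  also have "\<dots> dvd (5 ^ v * (A choose i)) * 5 ^ (6 + d)"
    using dvd by (intro mult_dvd_mono le_imp_power_dvd) auto
  also have "\<dots> = (A choose i) * 5 ^ i"
    by (simp add: d power_add)
  finally show ?thesis .
qed

lemma choose_falling: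
  fixes n :: nat
  shows "2 * int (n choose 2) = int n * (int n - 1)"
    "6 * int (n choose 3) = int n * (int n - 1) * (int n - 2)"
    "24 * int (n choose 4) = int n * (int n - 1) * (int n - 2) * (int n - 3)"
    "120 * int (n choose 5) = int n * (int n - 1) * (int n - 2) * (int n - 3) * (int n - 4)"
proof -
  have step: "int (Suc k) * int (n choose Suc k) = (int n - int k) * int (n choose k)" for k
  proof (cases "k \<le> n")
    case True
    then show ?thesis
      using Suc_times_binomial_eq[of "n" k] binomial_absorb_comp[of n k]
      by (metis binomial_absorption of_nat_diff of_nat_mult)
  qed (simp add: binomial_eq_0)
  show 2: "2 * int (n choose 2) = int n * (int n - 1)"
    using step[of 1] by (simp add: eval_nat_numeral algebra_simps)
  show 3: "6 * int (n choose 3) = int n * (int n - 1) * (int n - 2)"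
    using step[of 2] arg_cong[OF 2, of "(*) (int n - 2)"] by (simp add: eval_nat_numeral algebra_simps)
  show 4: "24 * int (n choose 4) = int n * (int n - 1) * (int n - 2) * (int n - 3)"
    using step[of 3] arg_cong[OF 3, of "(*) (int n - 3)"] by (simp add: eval_nat_numeral algebra_simps)
  show 5: "120 * int (n choose 5) = int n * (int n - 1) * (int n - 2) * (int n - 3) * (int n - 4)"
    using step[of 4] arg_cong[OF 4, of "(*) (int n - 4)"] by (simp add: eval_nat_numeral algebra_simps)
qed


section \<open>Difference calculus and the linear part of Newton's formula\<close>

lemma funpow_fdiff_add: "(fdiff ^^ r) (\<lambda>t. f t + g t) t = (fdiff ^^ r) f t + (fdiff ^^ r) g t"
  by (induction r arbitrary: t) (auto simp: fdiff_def)

lemma funpow_fdiff_diff: "(fdiff ^^ r) (\<lambda>t. f t - g t) t = (fdiff ^^ r) f t - (fdiff ^^ r) g t"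
  by (induction r arbitrary: t) (auto simp: fdiff_def)

lemma funpow_fdiff_cmult: "(fdiff ^^ r) (\<lambda>t. c * f t) t = c * (fdiff ^^ r) f t"
  by (induction r arbitrary: t) (auto simp: fdiff_def algebra_simps)

lemma funpow_fdiff_funpow: "(fdiff ^^ r) ((fdiff ^^ s) f) t = (fdiff ^^ (r + s)) f t"
  by (simp add: funpow_add)

text \<open>Repeated summation recovers \<open>f\<close> from its first \<open>r\<close> values and
  its \<open>r\<close>-th difference by integer additions alone.\<close>

lemma dvd_if_dvd_funpow_fdiff:
  assumes "\<And>i. i < r \<Longrightarrow> n dvd f i" and "\<And>t. n dvd (fdiff ^^ r) f t"
  shows "n dvd f t"
  using assms
proof (induction r arbitrary: f t)
  case (Suc r)
  have step: "n dvd fdiff f t" for t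
  proof (rule Suc.IH)
    show "n dvd fdiff f i" if "i < r" for i
      using Suc.prems(1)[of i] Suc.prems(1)[of "Suc i"] that by (simp add: fdiff_def)
    show "n dvd (fdiff ^^ r) (fdiff f) t" for t
      using Suc.prems(2)[of t] by (simp only: funpow_Suc_right o_apply)
  qed
  show ?case
  proof (induction t)
    case 0
    show ?case using Suc.prems(1) by simp
  next
    case (Suc t)
    have "f (Suc t) = fdiff f t + f t" by (simp add: fdiff_def)
    with Suc step[of t] show ?case by simp
  qed
qed simp

text \<open>
  \<open>120 log (1 + \<Delta>)\<close> up to order 5: the factor clears the denominators 2, ..., 5 and also those of
  the binomial coefficients in Newton's formula. As it contains one factor 5, every modulus below
  carries an extra factor 5.
\<close>

definition log_fdiff :: "(nat \<Rightarrow> int) \<Rightarrow> nat \<Rightarrow> int" where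
  "log_fdiff f t = 120 * (fdiff ^^ 1) f t - 60 * (fdiff ^^ 2) f t + 40 * (fdiff ^^ 3) f t
     - 30 * (fdiff ^^ 4) f t + 24 * (fdiff ^^ 5) f t"

lemma log_fdiff_expand:
  "log_fdiff f t = 24 * f (t + 5) - 150 * f (t + 4) + 400 * f (t + 3) - 600 * f (t + 2)
     + 600 * f (t + 1) - 274 * f t"
  by (simp add: log_fdiff_def fdiff_def eval_nat_numeral)

text \<open>The parts linear in \<open>A\<close> of the terms of order at most 5 add up to
  \<open>int A * log_fdiff f t\<close>. The terms of order at least 6 vanish by
  \<open>choose_dvd_bound\<close>, with one more 5 from 120, and the higher powers of
  \<open>A\<close> by their size.\<close>

lemma newton_forward_cong:
  assumes f: "\<And>r. 5 ^ r dvd (fdiff ^^ r) f t" and "m \<ge> 5" and A: "5 ^ (m - 1) dvd A"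
  shows "[120 * (f (t + A) - f t) = int A * log_fdiff f t] (mod 5 ^ (m + 6))"
proof -
  define D where "D i = (fdiff ^^ i) f t" for i
  define a where "a = int A"
  have tail: "5 ^ (m + 6) dvd 120 * (\<Sum>i=6..A + 5. int (A choose i) * D i)"
  proof -
    have "5 ^ (m + 5) dvd int (A choose i) * D i" if "i \<in> {6..A + 5}" for i
    proof -
      have "int (5 ^ (m + 5)) dvd int ((A choose i) * 5 ^ i)"
        using choose_dvd_bound[of i m A] that assms by (simp only: of_nat_dvd_iff) simp
      also have "\<dots> dvd int (A choose i) * D i"
        using f by (simp add: D_def mult_dvd_mono)
      finally show ?thesis by simp
    qed
    then have "5 * 5 ^ (m + 5) dvd 120 * (\<Sum>i=6..A + 5. int (A choose i) * D i)"
      by (intro mult_dvd_mono dvd_sum) auto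
    moreover have "(5::int) * 5 ^ (m + 5) = 5 ^ (m + 6)" by (simp add: power_add)
    ultimately show ?thesis by (simp only:)
  qed
  \<comment> \<open>\<open>a\<^sup>2 Q\<close> collects what is at least quadratic in \<open>a\<close> among the Newton terms of order at most 5.\<close>
  define Q where "Q = 60 * D 2 + 20 * (a - 3) * D 3 + 5 * (a\<^sup>2 - 6 * a + 11) * D 4
      + (a ^ 3 - 10 * a\<^sup>2 + 35 * a - 50) * D 5"
  have "5 ^ 3 dvd Q"
  proof -
    have "5 ^ 3 dvd D 3" "5 ^ 3 dvd D 4" "5 ^ 3 dvd D 5"
      using f le_imp_power_dvd[of 3 _ "5::int"] unfolding D_def by (meson dvd_trans numeral_le_iff semiring_norm)+
    \<comment> \<open>\<open>D 2\<close> carries only \<open>5 ^ 2\<close>; the third 5 comes from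
      the coefficient 60.\<close>
    moreover have "5 ^ 3 dvd 60 * D 2"
      using mult_dvd_mono[of 5 60 "5 ^ 2" "D 2"] f[of 2] unfolding D_def by simp
    ultimately show ?thesis
      unfolding Q_def by (intro dvd_add) (assumption | rule dvd_mult, assumption)+
  qed
  moreover have "(5 ^ (m - 1))\<^sup>2 dvd a\<^sup>2"
  proof -
    have "int (5 ^ (m - 1)) dvd a" unfolding a_def using A by (simp only: of_nat_dvd_iff)
    then show ?thesis by (intro dvd_power_same) simp
  qed
  ultimately have "(5 ^ (m - 1))\<^sup>2 * 5 ^ 3 dvd a\<^sup>2 * Q"
    by (intro mult_dvd_mono)
  \<comment> \<open>Here \<open>m \<ge> 5\<close> enters, as
    \<open>2 * (m - 1) + 3 \<ge> m + 6\<close>.\<close>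
  moreover have "(5::int) ^ (m + 6) dvd (5 ^ (m - 1))\<^sup>2 * 5 ^ 3"
    using assms(2) unfolding power_mult[symmetric] power_add[symmetric]
    by (intro le_imp_power_dvd) simp
  ultimately have Q: "5 ^ (m + 6) dvd a\<^sup>2 * Q" by (rule dvd_trans[rotated])
  have "f (t + A) = (\<Sum>i\<le>A. int (A choose i) * D i)"
    unfolding D_def by (rule newton_forward)
  \<comment> \<open>Terms beyond \<open>A\<close> are zero; padding by 5 makes the range contain all
    orders up to 5 even for small \<open>A\<close>.\<close>
  also have "\<dots> = (\<Sum>i\<le>A + 5. int (A choose i) * D i)"
    by (rule sum.mono_neutral_left) auto
  also have "{..A + 5} = {..5} \<union> {6..A + 5}" by auto
  also have "(\<Sum>i\<in>{..5} \<union> {6..A + 5}. int (A choose i) * D i)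
      = (\<Sum>i\<le>5. int (A choose i) * D i) + (\<Sum>i=6..A + 5. int (A choose i) * D i)"
    by (rule sum.union_disjoint) auto
  also have "(\<Sum>i\<le>5. int (A choose i) * D i) = f t + a * D 1 + int (A choose 2) * D 2
      + int (A choose 3) * D 3 + int (A choose 4) * D 4 + int (A choose 5) * D 5"
    by (simp add: eval_nat_numeral D_def a_def)
  finally have "120 * (f (t + A) - f t) = 120 * a * D 1 + 60 * (2 * int (A choose 2)) * D 2
      + 20 * (6 * int (A choose 3)) * D 3 + 5 * (24 * int (A choose 4)) * D 4
      + (120 * int (A choose 5)) * D 5 + 120 * (\<Sum>i=6..A + 5. int (A choose i) * D i)"
    by simp
  also have "\<dots> = a * log_fdiff f t + a\<^sup>2 * Q + 120 * (\<Sum>i=6..A + 5. int (A choose i) * D i)"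
    unfolding choose_falling log_fdiff_def Q_def a_def[symmetric] D_def[symmetric]
    by (simp add: algebra_simps power2_eq_square power3_eq_cube)
  finally show ?thesis
    using tail Q by (simp add: cong_iff_dvd_diff a_def)
qed

section \<open>The quartic polynomials in the two residue classes\<close>

text \<open>The fifth difference of \<open>log_fdiff f\<close> involves only differences of order 6
  to 10. Order 6 obtains its missing 5 from the coefficient 120, so five arguments decide the
  congruence. The modulus \<open>5 ^ 7\<close> and the factor \<open>5 ^ (m - 1)\<close> of the step
  \<open>A\<close> combine to \<open>5 ^ (m + 6)\<close>.\<close>

lemma log_fdiff_cong:
  assumes kummer: "\<And>r t. 5 ^ r dvd (fdiff ^^ r) f t"
    and P: "\<And>t. (fdiff ^^ 5) P t = 0"
    and base: "\<And>t. t < 5 \<Longrightarrow> [log_fdiff f t = P t] (mod 5 ^ 7)"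
  shows "[log_fdiff f t = P t] (mod 5 ^ 7)"
  unfolding cong_iff_dvd_diff
proof (rule dvd_if_dvd_funpow_fdiff[where f = "\<lambda>t. log_fdiff f t - P t" and r = 5])
  fix t
  have "(fdiff ^^ 5) (\<lambda>t. log_fdiff f t - P t) t
      = 120 * (fdiff ^^ 6) f t - 60 * (fdiff ^^ 7) f t + 40 * (fdiff ^^ 8) f t
        - 30 * (fdiff ^^ 9) f t + 24 * (fdiff ^^ 10) f t"
    unfolding log_fdiff_def funpow_fdiff_diff funpow_fdiff_add funpow_fdiff_cmult funpow_fdiff_funpow P
    by simp
  moreover have "5 ^ 7 dvd 120 * (fdiff ^^ 6) f t"
    using mult_dvd_mono[of 5 120 "5 ^ 6" "(fdiff ^^ 6) f t"] kummer[of 6 t] by simp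
  moreover have "5 ^ 7 dvd (fdiff ^^ r) f t" if "r \<ge> 7" for r
    using kummer[of r t] le_imp_power_dvd[OF that] by (rule dvd_trans[rotated])
  ultimately show "5 ^ 7 dvd (fdiff ^^ 5) (\<lambda>t. log_fdiff f t - P t) t"
    by (simp del: funpow.simps)
qed (use base in \<open>simp add: cong_iff_dvd_diff\<close>)

text \<open>Writing \<open>0 + 4 * t\<close> gives both residue classes the shape
  \<open>c + 4 * t\<close>, which later rewrites to \<open>b\<close> as a whole.\<close>

lemma log_fdiff_euler_number_5_0:
  "[log_fdiff (\<lambda>t. euler_number_5 (0 + 4 * t)) t =
     120 * (3130 - 4000 * int (0 + 4 * t) + 3375 * int (0 + 4 * t) ^ 2 + 3125 * int (0 + 4 * t) ^ 3
       - 3125 * int (0 + 4 * t) ^ 4)] (mod 5 ^ 7)"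
proof (rule log_fdiff_cong)
  fix t :: nat assume "t < 5"
  then consider "t = 0" | "t = 1" | "t = 2" | "t = 3" | "t = 4" by linarith
  then show "[log_fdiff (\<lambda>t. euler_number_5 (0 + 4 * t)) t =
     120 * (3130 - 4000 * int (0 + 4 * t) + 3375 * int (0 + 4 * t) ^ 2 + 3125 * int (0 + 4 * t) ^ 3
       - 3125 * int (0 + 4 * t) ^ 4)] (mod 5 ^ 7)"
    by cases (simp_all add: log_fdiff_expand euler_number_5_def euler_number_values cong_def)
next
  show "(fdiff ^^ 5) (\<lambda>t. 120 * (3130 - 4000 * int (0 + 4 * t) + 3375 * int (0 + 4 * t) ^ 2
      + 3125 * int (0 + 4 * t) ^ 3 - 3125 * int (0 + 4 * t) ^ 4)) t = 0" for t
    by (simp add: fdiff_def eval_nat_numeral algebra_simps)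
qed (rule kummer_congruence_5, simp)

lemma log_fdiff_euler_number_5_2:
  "[log_fdiff (\<lambda>t. euler_number_5 (2 + 4 * t)) t =
     120 * (4790 + 1750 * int (2 + 4 * t) ^ 2 + 3125 * int (2 + 4 * t) ^ 3
       + 6250 * int (2 + 4 * t) ^ 4)] (mod 5 ^ 7)"
proof (rule log_fdiff_cong)
  fix t :: nat assume "t < 5"
  then consider "t = 0" | "t = 1" | "t = 2" | "t = 3" | "t = 4" by linarith
  then show "[log_fdiff (\<lambda>t. euler_number_5 (2 + 4 * t)) t =
     120 * (4790 + 1750 * int (2 + 4 * t) ^ 2 + 3125 * int (2 + 4 * t) ^ 3
       + 6250 * int (2 + 4 * t) ^ 4)] (mod 5 ^ 7)"
    by cases (simp_all add: log_fdiff_expand euler_number_5_def euler_number_values euler_number_values(2)[unfolded numeral_2_eq_2] cong_def)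
next
  show "(fdiff ^^ 5) (\<lambda>t. 120 * (4790 + 1750 * int (2 + 4 * t) ^ 2
      + 3125 * int (2 + 4 * t) ^ 3 + 6250 * int (2 + 4 * t) ^ 4)) t = 0" for t
    by (simp add: fdiff_def eval_nat_numeral algebra_simps)
qed (rule kummer_congruence_5, simp)

section \<open>From \<open>log_fdiff\<close> to Euler numbers\<close>

text \<open>As the totient of \<open>5 ^ m\<close> is \<open>4 * 5 ^ (m - 1)\<close>, the index
  shift is \<open>A = 5 ^ (m - 1) * k\<close> steps of size 4. The new index \<open>n\<close> is at
  least \<open>m + 5\<close>, so the correction \<open>5 ^ n\<close> disappears there, while it
  stays visible at the old index.\<close>

lemma euler_number_cong_if_log_fdiff_cong:
  assumes "k \<ge> 1" and "m \<ge> 5" and "even c"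
    and F: "[log_fdiff (\<lambda>t. euler_number_5 (c + 4 * t)) t = 120 * F] (mod 5 ^ 7)"
  shows "[euler_number (k * totient (5 ^ m) + (c + 4 * t))
      - (1 - 5 ^ (c + 4 * t)) * euler_number (c + 4 * t) = 5 ^ (m - 1) * int k * F] (mod 5 ^ (m + 5))"
proof -
  define A where "A = 5 ^ (m - 1) * k"
  define n where "n = c + 4 * (t + A)"
  have n: "k * totient (5 ^ m) + (c + 4 * t) = n"
    using assms(2) by (simp add: totient_prime_power n_def A_def algebra_simps)
  have "4 \<le> p \<Longrightarrow> p + 6 \<le> 4 * 5 ^ p" for p :: nat
    by (induction p rule: dec_induct) auto
  moreover have "4 \<le> m - 1" using assms(2) by simp
  ultimately have "m - 1 + 6 \<le> 4 * 5 ^ (m - 1)" by blast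
  then have "m + 5 \<le> 4 * 5 ^ (m - 1)"
    using assms(2) by simp
  also have "\<dots> \<le> n"
  proof -
    have "5 ^ (m - 1) \<le> A" unfolding A_def using assms(1) by simp
    then show ?thesis unfolding n_def by simp
  qed
  finally have "5 ^ (m + 5) dvd 5 ^ n * euler_number n"
    by (intro dvd_mult2 le_imp_power_dvd)
  then have 1: "[euler_number n = euler_number_5 n] (mod 5 ^ (m + 5))"
    by (simp add: euler_number_5_def cong_iff_dvd_diff algebra_simps)
  have "[120 * (euler_number_5 n - euler_number_5 (c + 4 * t))
      = int A * log_fdiff (\<lambda>t. euler_number_5 (c + 4 * t)) t] (mod 5 ^ (m + 6))"
    unfolding n_def by (rule newton_forward_cong) (use assms kummer_congruence_5 in \<open>auto simp: A_def\<close>)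
  also have "[int A * log_fdiff (\<lambda>t. euler_number_5 (c + 4 * t)) t = int A * (120 * F)] (mod 5 ^ (m + 6))"
  proof -
    have "5 ^ (m - 1) * 5 ^ 7 dvd int A * (log_fdiff (\<lambda>t. euler_number_5 (c + 4 * t)) t - 120 * F)"
      using F by (intro mult_dvd_mono) (auto simp: A_def cong_iff_dvd_diff)
    moreover have "(5::int) ^ (m - 1) * 5 ^ 7 = 5 ^ (m + 6)"
      using assms(2) by (subst power_add[symmetric]) simp
    ultimately show ?thesis by (simp add: cong_iff_dvd_diff right_diff_distrib)
  qed
  finally have "[120 * (euler_number_5 n - euler_number_5 (c + 4 * t)) = int A * (120 * F)] (mod 5 ^ (m + 6))" .
  \<comment> \<open>Cancelling \<open>120 = 5 * 24\<close> costs one power of 5 in the modulus; 24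
    is a unit.\<close>
  moreover have "(5::int) ^ (m + 6) = 5 * 5 ^ (m + 5)" by (simp add: power_add)
  ultimately have "5 * 5 ^ (m + 5) dvd 5 * (24 * (euler_number_5 n - euler_number_5 (c + 4 * t) - int A * F))"
    by (simp add: cong_iff_dvd_diff algebra_simps)
  then have "5 ^ (m + 5) dvd 24 * (euler_number_5 n - euler_number_5 (c + 4 * t) - int A * F)"
    by (simp only: dvd_mult_cancel_left) simp
  moreover have "coprime (5 ^ (m + 5)) (24::int)"
    using prime_imp_coprime[of "5::int" 24] by simp
  ultimately have "[euler_number_5 n - euler_number_5 (c + 4 * t) = int A * F] (mod 5 ^ (m + 5))"
    by (simp only: coprime_dvd_mult_right_iff cong_iff_dvd_diff)
  with 1 have "[euler_number n - euler_number_5 (c + 4 * t) = int A * F] (mod 5 ^ (m + 5))"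
    by (meson cong_diff cong_refl cong_trans)
  then show ?thesis
    by (simp add: n euler_number_5_def A_def)
qed

theorem theorem4p1:
  fixes k m b :: nat
  assumes "k \<ge> 1" and "m \<ge> 5" and "even b"
  shows "([b = 0] (mod 4) \<longrightarrow>
           [euler_number (k * totient (5 ^ m) + b) - (1 - 5 ^ b) * euler_number b
            = 5 ^ (m - 1) * int k *
                (3130 - 4000 * int b + 3375 * int b ^ 2 + 3125 * int b ^ 3 - 3125 * int b ^ 4)]
           (mod 5 ^ (m + 5))) \<and>
         ([b = 2] (mod 4) \<longrightarrow>
           [euler_number (k * totient (5 ^ m) + b) - (1 - 5 ^ b) * euler_number b
            = 5 ^ (m - 1) * int k *
                (4790 + 1750 * int b ^ 2 + 3125 * int b ^ 3 + 6250 * int b ^ 4)]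
           (mod 5 ^ (m + 5)))"
proof (intro conjI impI)
  assume "[b = 0] (mod 4)"
  then have b: "0 + 4 * (b div 4) = b"
    using mult_div_mod_eq[of 4 b] by (simp add: cong_def)
  show "[euler_number (k * totient (5 ^ m) + b) - (1 - 5 ^ b) * euler_number b
      = 5 ^ (m - 1) * int k *
        (3130 - 4000 * int b + 3375 * int b ^ 2 + 3125 * int b ^ 3 - 3125 * int b ^ 4)] (mod 5 ^ (m + 5))"
    using euler_number_cong_if_log_fdiff_cong[OF assms(1,2) even_zero log_fdiff_euler_number_5_0[of "b div 4"]]
    unfolding b .
next
  assume "[b = 2] (mod 4)"
  then have b: "2 + 4 * (b div 4) = b"
    using mult_div_mod_eq[of 4 b] by (simp add: cong_def)
  show "[euler_number (k * totient (5 ^ m) + b) - (1 - 5 ^ b) * euler_number b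
      = 5 ^ (m - 1) * int k *
        (4790 + 1750 * int b ^ 2 + 3125 * int b ^ 3 + 6250 * int b ^ 4)] (mod 5 ^ (m + 5))"
    using euler_number_cong_if_log_fdiff_cong[OF assms(1,2) dvd_refl log_fdiff_euler_number_5_2[of "b div 4"]]
    unfolding b .
qed

end
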